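(* Let $(a,b)$, $-\infty\le a<b\le\infty$, be a non-empty real interval and $w$ a weight function on $(a,b)$ with $w(a)=w(b)=0$. The differentiation matrix $\mathcal{D}$ of the system of W-functions of $w$ is banded if and only if $(a,b)=\mathbb{R}$ and $w(x)=e^{-c(x)}$, $x\in\mathbb{R}$, where $c$ is a polynomial of even degree whose highest-degree coefficient is strictly positive.
   Context: A weight function on $(a,b)$ is a positive function $w\in L_2(a,b)\cap C^1(a,b)$ all of whose moments $\int_a^b x^k w(x)\,dx$, $k\in\mathbb{Z}_+=\{0,1,2,\dots\}$, are finite. $\{p_n\}_{n\in\mathbb{Z}_+}$ denotes the orthonormal polynomials, $\deg p_n=n$, positive leading coefficient, $\int_a^b p_m p_n w\,dx=\delta_{m,n}$. The $n$-th W-function is $\varphi_n=\sqrt{w}\,p_n$, and the differentiation matrix is $\mathcal{D}_{m,n}=\int_a^b \varphi_m'(x)\varphi_n(x)\,dx$, $m,n\in\mathbb{Z}_+$. The values $w(a),w(b)$ are understood as limits at the endpoints. $\mathcal{D}$ is banded if there is an integer $L\ge 0$ such that $\mathcal{D}_{m,n}=0$ whenever $|m-n|\ge L+1$. *)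

theory Defs
  imports "HOL-Analysis.Analysis" "HOL-Computational_Algebra.Polynomial"
begin

definition weight_function :: "ereal \<Rightarrow> ereal \<Rightarrow> (real \<Rightarrow> real) \<Rightarrow> bool" where
  "weight_function a b w \<longleftrightarrow>
     (\<forall>x\<in>einterval a b. w x > 0) \<and>
     set_integrable lborel (einterval a b) (\<lambda>x. (w x)\<^sup>2) \<and>
     w C1_differentiable_on einterval a b \<and>
     (\<forall>k::nat. set_integrable lborel (einterval a b) (\<lambda>x. x ^ k * w x))"

text \<open>The endpoint values are one-sided limits, taken in the extended reals so that infinite
  endpoints are covered.\<close>

definition vanishes_at_endpoints :: "ereal \<Rightarrow> ereal \<Rightarrow> (real \<Rightarrow> real) \<Rightarrow> bool" where
  "vanishes_at_endpoints a b w \<longleftrightarrow>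
     ((w \<circ> real_of_ereal) \<longlongrightarrow> 0) (at_right a) \<and> ((w \<circ> real_of_ereal) \<longlongrightarrow> 0) (at_left b)"

definition orthonormal_polys ::
    "ereal \<Rightarrow> ereal \<Rightarrow> (real \<Rightarrow> real) \<Rightarrow> (nat \<Rightarrow> real poly) \<Rightarrow> bool" where
  "orthonormal_polys a b w p \<longleftrightarrow>
     (\<forall>n. degree (p n) = n \<and> lead_coeff (p n) > 0) \<and>
     (\<forall>m n. (LINT x:einterval a b|lborel. poly (p m) x * poly (p n) x * w x) =
              (if m = n then 1 else 0))"

definition W_function :: "(real \<Rightarrow> real) \<Rightarrow> (nat \<Rightarrow> real poly) \<Rightarrow> nat \<Rightarrow> real \<Rightarrow> real" where
  "W_function w p n x = sqrt (w x) * poly (p n) x"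

text \<open>The conditions on a weight function do not force the integrals defining the
  differentiation matrix to converge: at an infinite endpoint, \<open>w\<close> may tend to 0 with ever narrower
  spikes while \<open>x * w x\<close> has no limit. Since a divergent integral has the value 0 here, the
  existence of the matrix is a separate predicate. The integral is that of Henstock and Kurzweil,
  which agrees with the Lebesgue integral where the latter exists and also covers conditionally
  convergent improper integrals.\<close>

definition diff_matrix_exists ::
    "ereal \<Rightarrow> ereal \<Rightarrow> (real \<Rightarrow> real) \<Rightarrow> (nat \<Rightarrow> real poly) \<Rightarrow> bool" where
  "diff_matrix_exists a b w p \<longleftrightarrow>
     (\<forall>m n. (\<lambda>x. deriv (W_function w p m) x * W_function w p n x) integrable_on einterval a b)"

definition diff_matrix ::
    "ereal \<Rightarrow> ereal \<Rightarrow> (real \<Rightarrow> real) \<Rightarrow> (nat \<Rightarrow> real poly) \<Rightarrow> nat \<Rightarrow> nat \<Rightarrow> real" where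
  "diff_matrix a b w p m n =
     integral (einterval a b) (\<lambda>x. deriv (W_function w p m) x * W_function w p n x)"

definition banded :: "(nat \<Rightarrow> nat \<Rightarrow> real) \<Rightarrow> bool" where
  "banded D \<longleftrightarrow> (\<exists>L::nat. \<forall>m n. \<bar>int m - int n\<bar> \<ge> int L + 1 \<longrightarrow> D m n = 0)"

end

theory Submission
  imports Defs "HOL-Probability.Levy"
begin

text \<open>
  Write \<open>v\<close> for the weight extended by 0 to the real line, and \<open>\<Lambda> q\<close> for the integral of \<open>v q\<close>. Integration
  by parts, whose boundary terms vanish, gives \<open>D\<^sub>m\<^sub>n = \<Lambda> (p\<^sub>m' p\<^sub>n - p\<^sub>m p\<^sub>n') / 2\<close>
  (\<open>diff_matrix_eq_moment\<close>).

  Suppose that \<open>D\<close> is banded. As \<open>p\<^sub>0\<close> is constant, the column \<open>n = 0\<close> says that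
  \<open>\<Lambda> p\<^sub>m' = 0\<close> for all large \<open>m\<close>, and so
  there is a polynomial \<open>r\<close> with \<open>\<Lambda> (q' + r q) = 0\<close> for all polynomials \<open>q\<close>
  (\<open>ex_pearson_functional\<close>). Formally this is the equation \<open>v' = r v\<close>, but it is only tested on
  polynomials, and a weight need not be determined by its moments. Here it is: the equation is a
  recursion for the moments which forces them to grow at most like \<open>C\<^sup>n n!\<close>, so that \<open>v\<close> has an
  exponential moment, and functions with an exponential moment that have the same moments agree
  (\<open>AE_eq_0_of_moments_eq_0\<close>). Comparing \<open>v\<close> with the antiderivative of \<open>r v\<close> that vanishes at
  \<open>-\<infinity>\<close> yields \<open>v' = r v\<close> on the whole line (\<open>pearson_functional_imp_ode\<close>). Therefore \<open>v\<close> is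
  a positive multiple of \<open>exp R\<close> with \<open>R' = r\<close>. It has no zeros, so the interval is the real line, and
  integrability at both ends determines the parity of the degree and the sign of the leading coefficient.

  Conversely, for \<open>w = exp (- c)\<close> on the line one has \<open>w' = - c' w\<close>, and hence
  \<open>D\<^sub>m\<^sub>n = \<Lambda> ((p\<^sub>m' - c' p\<^sub>m / 2) p\<^sub>n)\<close>. By orthogonality this is 0 if \<open>n > m + deg c\<close>, and the antisymmetry of
  \<open>D\<close> gives the other half of the band condition.
\<close>

section \<open>Vanishing of boundary terms\<close>

lemma integrable_small_at_top:
  fixes f :: "real \<Rightarrow> real"
  assumes "integrable lborel f" "e > 0"
  obtains t where "t \<ge> B" "\<bar>f t\<bar> < e"
proof -
  have "\<exists>t\<ge>B. \<bar>f t\<bar> < e"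
  proof (rule ccontr)
    assume "\<not> ?thesis"
    then have large: "\<bar>f t\<bar> \<ge> e" if "t \<ge> B" for t
      using that by force
    have "e * real n \<le> (LINT x|lborel. \<bar>f x\<bar>)" for n
    proof -
      have "e * real n = (LINT x|lborel. e * indicator {B..B + real n} x)"
        by simp
      also have "\<dots> \<le> (LINT x|lborel. \<bar>f x\<bar>)"
        using assms large by (intro integral_mono) (auto split: split_indicator)
      finally show ?thesis .
    qed
    moreover obtain n :: nat where "(LINT x|lborel. \<bar>f x\<bar>) / e < real n"
      using reals_Archimedean2 by blast
    ultimately show False
      using \<open>e > 0\<close> by (auto simp: field_simps not_le[symmetric])
  qed
  then show ?thesis using that by blast
qed

text \<open>Applied to products with polynomials, this is integration by parts on the whole line. The limits of \<open>f\<close> at \<open>\<plusminus>\<infinity>\<close> may fail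
  to exist, but the integral of \<open>g\<close> over \<open>[-s, t]\<close> equals \<open>f t - f (-s)\<close> and is close to the total
  integral for all large \<open>s, t\<close>, and an integrable \<open>f\<close> is small at arbitrarily remote points.
  The integral of \<open>g\<close> is the one of Henstock and Kurzweil, since the derivative of a weight need not be
  absolutely integrable.\<close>

lemma integral_derivative_of_integrable_eq_0:
  fixes f g :: "real \<Rightarrow> real"
  assumes cont: "continuous_on UNIV f" and "finite S"
    and deriv: "\<And>x. x \<notin> S \<Longrightarrow> (f has_vector_derivative g x) (at x)"
    and f: "integrable lborel f" and g: "g integrable_on UNIV"
  shows "integral UNIV g = 0"
proof -
  define J where "J = integral UNIV g"
  have "\<bar>J\<bar> \<le> 3 * e" if "e > 0" for e
  proof -
    have "(g has_integral J) UNIV"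
      using g by (auto simp: J_def)
    then obtain B where B: "\<And>s t. ball 0 B \<subseteq> cbox s t \<Longrightarrow> norm (integral (cbox s t) g - J) < e"
      using \<open>e > 0\<close> unfolding has_integral_alt' by auto meson
    obtain t where t: "t \<ge> max B 0" "\<bar>f t\<bar> < e"
      using integrable_small_at_top[OF f \<open>e > 0\<close>] .
    have "integrable lborel (\<lambda>x. f (- x))"
      using lborel_integrable_real_affine[OF f, of "-1" 0] by simp
    then obtain s where s: "s \<ge> max B 0" "\<bar>f (- s)\<bar> < e"
      using integrable_small_at_top[OF _ \<open>e > 0\<close>] by blast
    have "(g has_integral (f t - f (- s))) {- s..t}"
      using s t by (intro fundamental_theorem_of_calculus_interior_strong[OF \<open>finite S\<close>])
        (auto intro: deriv continuous_on_subset[OF cont])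
    then have "integral (cbox (- s) t) g = f t - f (- s)"
      by (simp add: integral_unique)
    moreover have "norm (integral (cbox (- s) t) g - J) < e"
      using s t by (intro B) (auto simp: ball_def dist_real_def)
    ultimately show ?thesis
      using s t by simp
  qed
  (* For J \<noteq> 0 this choice of e gives \<bar>J\<bar> \<le> \<bar>J\<bar> / 2. *)
  from this[of "\<bar>J\<bar> / 6"] show ?thesis
    unfolding J_def[symmetric] by (cases "J = 0") auto
qed

text \<open>Vanishing at the finite endpoints is exactly what makes the extension of the weight by 0 continuous
  on the whole line. From here on intervals, finite or not, are replaced by the line, with at most two
  points where the extended weight is not differentiable.\<close>

lemma continuous_zero_extension:
  assumes cont: "continuous_on (einterval a b) w" and vanish: "vanishes_at_endpoints a b w"
  shows "continuous_on UNIV (\<lambda>x. indicator (einterval a b) x * w x :: real)" (is "continuous_on _ ?v")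
proof (rule continuous_at_imp_continuous_on, rule ballI)
  fix x :: real
  show "isCont ?v x"
  proof (cases "x \<in> einterval a b")
    case True
    then have "isCont w x"
      using cont continuous_on_eq_continuous_at open_einterval by blast
    moreover have "eventually (\<lambda>y. ?v y = w y) (nhds x)"
      using eventually_nhds_in_open[OF open_einterval True] by eventually_elim simp
    ultimately show ?thesis
      using isCont_cong by fastforce
  next
    case False
    (* As the extension is dominated by the absolute value of w, limits of w suffice. *)
    have dom: "(?v \<longlongrightarrow> 0) F" if "(w \<longlongrightarrow> 0) F" for F
      by (rule Lim_null_comparison[OF _ tendsto_rabs_zero[OF that]])
        (auto split: split_indicator)
    have "(?v \<longlongrightarrow> 0) (at_right x)"
    proof -
      consider "ereal x = a" | "ereal x < a" | "b \<le> ereal x"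
        using False by (auto simp: einterval_iff not_less le_less)
      then show ?thesis
      proof cases
        case 1
        then have "(w \<longlongrightarrow> 0) (at_right x)"
          using vanish unfolding vanishes_at_endpoints_def
          by (auto simp: at_right_ereal tendsto_compose_filtermap filtermap_filtermap filtermap_ident comp_def filterlim_def)
        then show ?thesis by (rule dom)
      next
        case 2
        then obtain c where c: "ereal x < ereal c" "ereal c < a"
          using ereal_dense2 by blast
        have "eventually (\<lambda>y. ?v y = 0) (at_right x)"
          using eventually_at_right_less[of x] eventually_at_right[of x c] c
          by (auto simp: eventually_at_right[of x c] einterval_iff split: split_indicator
              intro!: exI[of _ c]) (meson ereal_less_le less_trans less_ereal.simps(1) less_asym)
        then show ?thesis by (rule tendsto_eventually)
      next
        case 3
        have "eventually (\<lambda>y. ?v y = 0) (at_right x)"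
          using eventually_at_right_less[of x]
        proof eventually_elim
          case (elim y)
          then have "b \<le> ereal y" using 3 by (meson ereal_less_eq(3) less_imp_le order_trans)
          then show ?case by (auto simp: einterval_iff split: split_indicator)
        qed
        then show ?thesis by (rule tendsto_eventually)
      qed
    qed
    moreover have "(?v \<longlongrightarrow> 0) (at_left x)"
    proof -
      consider "ereal x = b" | "b < ereal x" | "ereal x \<le> a"
        using False by (auto simp: einterval_iff not_less le_less)
      then show ?thesis
      proof cases
        case 1
        then have "(w \<longlongrightarrow> 0) (at_left x)"
          using vanish unfolding vanishes_at_endpoints_def
          by (auto simp: at_left_ereal tendsto_compose_filtermap filtermap_filtermap filtermap_ident comp_def filterlim_def)
        then show ?thesis by (rule dom)
      next
        case 2
        then obtain c where c: "b < ereal c" "ereal c < ereal x"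
          using ereal_dense2 by blast
        have "eventually (\<lambda>y. ?v y = 0) (at_left x)"
          using c eventually_at_left_real[of c x]
          by (auto simp: einterval_iff split: split_indicator elim!: eventually_mono)
            (meson less_trans less_ereal.simps(1) less_asym)
        then show ?thesis by (rule tendsto_eventually)
      next
        case 3
        have "eventually (\<lambda>y. ?v y = 0) (at_left x)"
          using eventually_at_left_real[of "x - 1" x, simplified]
        proof eventually_elim
          case (elim y)
          then have "ereal y \<le> a" using 3
            by (meson ereal_less_eq(3) greaterThanLessThan_iff less_imp_le order_trans)
          then show ?case by (auto simp: einterval_iff split: split_indicator)
        qed
        then show ?thesis by (rule tendsto_eventually)
      qed
    qed
    ultimately show ?thesis
      using False by (simp add: continuous_at filterlim_at_split)
  qed
qed

section \<open>Moments and orthogonal polynomials\<close>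

definition moment :: "(real \<Rightarrow> real) \<Rightarrow> real poly \<Rightarrow> real" where
  "moment v q = (LINT x|lborel. v x * poly q x)"

lemma integrable_times_poly:
  assumes "\<And>k::nat. integrable lborel (\<lambda>x::real. x ^ k * v x)"
  shows "integrable lborel (\<lambda>x. v x * poly q x :: real)"
proof -
  have "integrable lborel (\<lambda>x. \<Sum>k\<le>degree q. coeff q k * (x ^ k * v x))"
    using assms by (intro Bochner_Integration.integrable_sum integrable_mult_right)
  then show ?thesis
    by (simp add: poly_altdef sum_distrib_left ac_simps)
qed

lemma moment_add:
  assumes "\<And>k::nat. integrable lborel (\<lambda>x. x ^ k * v x)"
  shows "moment v (q + r) = moment v q + moment v r"
  using integrable_times_poly[OF assms] by (simp add: moment_def distrib_left)

lemma moment_smult: "moment v (smult c q) = c * moment v q"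
  by (simp add: moment_def mult.left_commute)

lemma moment_sum:
  assumes "\<And>k::nat. integrable lborel (\<lambda>x. x ^ k * v x)"
  shows "moment v (sum f A) = (\<Sum>i\<in>A. moment v (f i))"
  by (induction A rule: infinite_finite_induct) (simp_all add: moment_add[OF assms], simp_all add: moment_def)

text \<open>Subtracting a multiple of the member of degree \<open>n - 1\<close> kills the coefficient of that degree.\<close>

lemma poly_graded_basis_expansion:
  fixes p :: "nat \<Rightarrow> real poly"
  assumes deg: "\<And>n. degree (p n) = n" and nz: "\<And>n. p n \<noteq> 0"
    and "q = 0 \<or> degree q < n"
  shows "\<exists>a. q = (\<Sum>k<n. smult (a k) (p k))"
  using assms(3)
proof (induction n arbitrary: q)
  case (Suc n)
  define c where "c = coeff q n / lead_coeff (p n)"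
  let ?q = "q - smult c (p n)"
  have "degree ?q \<le> n"
    using Suc.prems by (intro degree_diff_le) (auto simp: deg)
  moreover have "lead_coeff (p n) \<noteq> 0"
    using nz by simp
  then have "coeff ?q n = 0"
    by (simp add: c_def deg)
  ultimately have "?q = 0 \<or> degree ?q < n"
    by (metis le_neq_implies_less leading_coeff_0_iff)
  then obtain a where "?q = (\<Sum>k<n. smult (a k) (p k))"
    using Suc.IH by blast
  then have "q = (\<Sum>k<Suc n. smult ((a(n := c)) k) (p k))"
    by (simp add: algebra_simps)
  then show ?case by blast
qed simp

lemma moment_orthogonal_lower_degree:
  fixes p :: "nat \<Rightarrow> real poly"
  assumes int: "\<And>k::nat. integrable lborel (\<lambda>x. x ^ k * v x)"
    and deg: "\<And>n. degree (p n) = n" and nz: "\<And>n. p n \<noteq> 0"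
    and orth: "\<And>m n. m \<noteq> n \<Longrightarrow> moment v (p m * p n) = 0"
    and "degree q < n"
  shows "moment v (q * p n) = 0"
proof -
  obtain a where "q = (\<Sum>k<n. smult (a k) (p k))"
    using poly_graded_basis_expansion[of p q n] deg nz \<open>degree q < n\<close> by blast
  then show ?thesis
    by (simp add: sum_distrib_right moment_sum[OF int] moment_smult orth)
qed

text \<open>If the functional \<open>q \<mapsto> moment v q'\<close> annihilates all but finitely many \<open>p m\<close>, it is represented, in
  the inner product given by \<open>v\<close>, by a polynomial: the truncated Fourier expansion \<open>- r\<close>.
  This is the weak form, tested on polynomials only, of the Pearson equation \<open>v' = r v\<close>.\<close>

lemma ex_pearson_functional:
  fixes p :: "nat \<Rightarrow> real poly"
  assumes int: "\<And>k::nat. integrable lborel (\<lambda>x. x ^ k * v x)"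
    and deg: "\<And>n. degree (p n) = n" and nz: "\<And>n. p n \<noteq> 0"
    and orth: "\<And>m n. moment v (p m * p n) = (if m = n then 1 else 0)"
    and deriv_0: "\<And>m. m > L \<Longrightarrow> moment v (pderiv (p m)) = 0"
  obtains r where "\<And>q. moment v (pderiv q + r * q) = 0"
proof
  (* The sign: r represents the functional that sends q to - moment v q'. *)
  define r where "r = (\<Sum>k\<le>L. smult (- moment v (pderiv (p k))) (p k))"
  have r: "moment v (r * p m) = - moment v (pderiv (p m))" for m
  proof -
    have "moment v (r * p m) = (\<Sum>k\<le>L. if k = m then - moment v (pderiv (p k)) else 0)"
      unfolding r_def sum_distrib_right moment_sum[OF int]
      by (intro sum.cong) (simp_all only: mult_smult_left moment_smult orth, simp)
    then show ?thesis
      using deriv_0[of m] by (auto simp: not_le)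
  qed
  show "moment v (pderiv q + r * q) = 0" for q
  proof -
    have "q = 0 \<or> degree q < Suc (degree q)"
      by simp
    from poly_graded_basis_expansion[OF deg nz this]
    obtain a N where q: "q = (\<Sum>k<N. smult (a k) (p k))"
      by blast
    have "pderiv q + r * q = (\<Sum>k<N. smult (a k) (pderiv (p k) + r * p k))"
      by (simp add: q higher_pderiv_sum[of 1, simplified] pderiv_smult sum_distrib_left sum.distrib smult_add_right)
    then show ?thesis
      by (simp add: moment_sum[OF int] moment_smult moment_add[OF int] r)
  qed
qed

section \<open>Exponential integrability from moment growth\<close>

lemma sum_power_over_fact_le_exp:
  fixes y :: real
  assumes "y \<ge> 0"
  shows "(\<Sum>k<n. y ^ k / fact k) \<le> exp y"
  using sum_le_suminf[OF summable_exp[of y], of "{..<n}"] assms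
  by (simp add: exp_def divide_inverse mult.commute)

lemma power_le_fact_mult_exp:
  fixes x :: real
  assumes "\<delta> > 0"
  shows "\<bar>x\<bar> ^ k \<le> fact k / \<delta> ^ k * exp (\<delta> * \<bar>x\<bar>)"
proof -
  have "(\<delta> * \<bar>x\<bar>) ^ k / fact k \<le> (\<Sum>j<Suc k. (\<delta> * \<bar>x\<bar>) ^ j / fact j)"
    using assms by (intro member_le_sum) auto
  also have "\<dots> \<le> exp (\<delta> * \<bar>x\<bar>)"
    using assms by (intro sum_power_over_fact_le_exp) auto
  finally show ?thesis
    using assms by (simp add: field_simps power_mult_distrib)
qed

lemma poly_le_exp:
  fixes q :: "real poly"
  assumes "\<delta> > 0"
  obtains K where "K \<ge> 0" "\<And>x. \<bar>poly q x\<bar> \<le> K * exp (\<delta> * \<bar>x\<bar>)"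
proof
  let ?K = "\<Sum>i\<le>degree q. \<bar>coeff q i\<bar> * (fact i / \<delta> ^ i)"
  show "?K \<ge> 0"
    using assms by (intro sum_nonneg) auto
  show "\<bar>poly q x\<bar> \<le> ?K * exp (\<delta> * \<bar>x\<bar>)" for x
  proof -
    have "\<bar>poly q x\<bar> \<le> (\<Sum>i\<le>degree q. \<bar>coeff q i\<bar> * \<bar>x\<bar> ^ i)"
      unfolding poly_altdef by (rule order_trans[OF sum_abs]) (simp add: abs_mult power_abs)
    also have "\<dots> \<le> (\<Sum>i\<le>degree q. \<bar>coeff q i\<bar> * (fact i / \<delta> ^ i * exp (\<delta> * \<bar>x\<bar>)))"
      by (intro sum_mono mult_left_mono power_le_fact_mult_exp assms) auto
    finally show ?thesis
      by (simp add: sum_distrib_left sum_distrib_right mult_ac)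
  qed
qed

lemma integrable_exp_neg_abs:
  fixes c :: real
  assumes "c > 0"
  shows "integrable lborel (\<lambda>x. exp (- c * \<bar>x\<bar>))"
proof -
  obtain K where K: "K \<ge> 0" "\<And>x. \<bar>poly [:1, 0, 1:] x\<bar> \<le> K * exp (c * \<bar>x\<bar>)"
    using poly_le_exp[OF assms, of "[:1, 0, 1:]"] by blast
  have "integrable lborel (\<lambda>x::real. inverse (1 + x\<^sup>2))"
    using integrable_inverse_1_plus_square by (simp add: set_integrable_def)
  from integrable_mult_right[OF this, of K] show ?thesis
  proof (rule Bochner_Integration.integrable_bound)
    show "AE x in lborel. norm (exp (- c * \<bar>x\<bar>)) \<le> norm (K * inverse (1 + x\<^sup>2))"
    proof (rule AE_I2)
      fix x :: real
      have "1 + x\<^sup>2 \<le> K * exp (c * \<bar>x\<bar>)" "1 + x\<^sup>2 > 0"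
        using K(2)[of x] by (auto simp: power2_eq_square add_pos_nonneg)
      then show "norm (exp (- c * \<bar>x\<bar>)) \<le> norm (K * inverse (1 + x\<^sup>2))"
        using K(1) by (simp add: exp_minus field_simps abs_mult)
    qed
  qed measurable
qed

text \<open>The recursion expresses \<open>s (n + d)\<close> by \<open>n * s (n - 1)\<close> and a bounded combination of the
  \<open>d\<close> preceding terms. The factor \<open>n\<close> is absorbed by the factorial and the bounded combination
  by a further factor \<open>C\<close>.\<close>

lemma recursion_imp_factorial_growth:
  fixes s r :: "nat \<Rightarrow> real"
  assumes nz: "r d \<noteq> 0"
    and rec: "\<And>n. real n * s (n - 1) + (\<Sum>j\<le>d. r j * s (n + j)) = 0"
  obtains C where "C \<ge> 1" "\<And>n. \<bar>s n\<bar> \<le> C ^ (n + 1) * fact n"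
proof -
  define K where "K = (1 + (\<Sum>j<d. \<bar>r j\<bar>)) / \<bar>r d\<bar>"
  define C where "C = 1 + K + (\<Sum>i\<le>d. \<bar>s i\<bar>)"
  have "K \<ge> 0"
    by (auto simp: K_def intro!: divide_nonneg_nonneg add_nonneg_nonneg sum_nonneg)
  moreover have "(\<Sum>i\<le>d. \<bar>s i\<bar>) \<ge> 0"
    by (intro sum_nonneg) auto
  ultimately have C: "C \<ge> 1" "K \<le> C"
    by (auto simp: C_def)
  have mono: "C ^ (i + 1) * fact i \<le> C ^ n * fact n" if "i < n" for i n
    using that C by (intro mult_mono power_increasing fact_mono) auto
  have "\<bar>s n\<bar> \<le> C ^ (n + 1) * fact n" for n
  proof (induction n rule: less_induct)
    case (less n)
    show ?case
    proof (cases "n \<le> d")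
      case True
      have "\<bar>s n\<bar> \<le> (\<Sum>i\<le>d. \<bar>s i\<bar>)"
        using True by (intro member_le_sum) auto
      also have "\<dots> \<le> C * 1"
        using \<open>K \<ge> 0\<close> by (simp add: C_def)
      also have "\<dots> \<le> C ^ (n + 1) * fact n"
        using C by (intro mult_mono fact_ge_1) (auto simp: one_le_power)
      finally show ?thesis .
    next
      case False
      then obtain m where n: "n = m + d" and "m > 0"
        by (metis add.commute le_add_diff_inverse less_le_not_le linorder_le_cases add_diff_cancel_left' zero_less_diff)
      have "(\<Sum>j\<le>d. r j * s (m + j)) = (\<Sum>j<d. r j * s (m + j)) + r d * s n"
        by (simp add: n atMost_Suc lessThan_Suc_atMost[symmetric])
      then have "r d * s n = - (real m * s (m - 1) + (\<Sum>j<d. r j * s (m + j)))"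
        using rec[of m] by simp
      then have "\<bar>r d\<bar> * \<bar>s n\<bar> = \<bar>real m * s (m - 1) + (\<Sum>j<d. r j * s (m + j))\<bar>"
        by (metis abs_minus_cancel abs_mult)
      also have "\<dots> \<le> real m * \<bar>s (m - 1)\<bar> + (\<Sum>j<d. \<bar>r j\<bar> * \<bar>s (m + j)\<bar>)"
        by (rule order_trans[OF abs_triangle_ineq])
          (auto simp: abs_mult intro!: add_mono order_trans[OF sum_abs])
      also have "\<dots> \<le> C ^ n * fact n + (\<Sum>j<d. \<bar>r j\<bar> * (C ^ n * fact n))"
      proof (intro add_mono sum_mono mult_left_mono)
        have "real m * \<bar>s (m - 1)\<bar> \<le> real m * (C ^ (m - 1 + 1) * fact (m - 1))"
          using \<open>m > 0\<close> by (intro mult_left_mono less) (auto simp: n)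
        also have "\<dots> = C ^ m * fact m"
          using \<open>m > 0\<close> by (cases m) (auto simp: algebra_simps)
        also have "\<dots> \<le> C ^ n * fact n"
          using C by (intro mult_mono power_increasing fact_mono) (auto simp: n)
        finally show "real m * \<bar>s (m - 1)\<bar> \<le> C ^ n * fact n" .
        show "\<bar>s (m + j)\<bar> \<le> C ^ n * fact n" if "j \<in> {..<d}" for j
          using less[of "m + j"] mono[of "m + j" n] that by (auto simp: n)
      qed auto
      also have "\<dots> = \<bar>r d\<bar> * (K * (C ^ n * fact n))"
        using nz by (simp add: K_def sum_distrib_left field_simps)
      also have "\<dots> \<le> \<bar>r d\<bar> * (C * (C ^ n * fact n))"
        using C by (intro mult_left_mono mult_right_mono) auto
      finally show ?thesis
        using nz by (simp add: algebra_simps)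
    qed
  qed
  with C show ?thesis using that by blast
qed

text \<open>Integrate the power series of \<open>cosh (\<delta> * x)\<close> term by term: only even powers occur, so all terms are
  nonnegative, and for small \<open>\<delta>\<close> the moments are dominated by a geometric series.\<close>

lemma exp_integrable_of_moment_growth:
  fixes v :: "real \<Rightarrow> real"
  assumes [measurable]: "v \<in> borel_measurable borel" and nonneg: "\<And>x. v x \<ge> 0"
    and int: "\<And>k::nat. integrable lborel (\<lambda>x. x ^ k * v x)"
    and "C \<ge> 1" and bound: "\<And>k. \<bar>LINT x|lborel. x ^ k * v x\<bar> \<le> C ^ (k + 1) * fact k"
  obtains \<delta> where "\<delta> > 0" "integrable lborel (\<lambda>x. v x * exp (\<delta> * \<bar>x\<bar>))"
proof -
  define \<delta> where "\<delta> = 1 / (2 * C)"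
  have \<delta>: "\<delta> > 0" "\<delta> * C = 1 / 2"
    using \<open>C \<ge> 1\<close> by (auto simp: \<delta>_def)
  define f where "f i x = (if even i then (\<delta> ^ i / fact i) * (x ^ i * v x) else 0)" for i x
  have f_nonneg: "f i x \<ge> 0" for i x
    using nonneg \<delta> by (auto simp: f_def intro!: mult_nonneg_nonneg zero_le_even_power)
  have f_int: "integrable lborel (f i)" for i
    using integrable_mult_right[OF int[of i], of "\<delta> ^ i / fact i"]
    by (cases "even i") (simp_all add: f_def[abs_def])
  have f_sums: "(\<lambda>i. f i x) sums (v x * cosh (\<delta> * x))" for x
    using sums_mult[OF cosh_converges[of "\<delta> * x"], of "v x"]
    by (rule sums_cong[THEN iffD1, rotated]) (auto simp: f_def power_mult_distrib field_simps)
  have "integrable lborel (\<lambda>x. \<Sum>i. f i x)"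
  proof (rule integrable_suminf[OF f_int])
    show "AE x in lborel. summable (\<lambda>i. norm (f i x))"
      using sums_summable[OF f_sums] f_nonneg by simp
    have le: "(LINT x|lborel. f i x) \<le> C * (1 / 2) ^ i" for i
    proof (cases "even i")
      case True
      have "(LINT x|lborel. f i x) = \<delta> ^ i / fact i * (LINT x|lborel. x ^ i * v x)"
        using True by (simp add: f_def)
      also have "\<dots> \<le> \<delta> ^ i / fact i * (C ^ (i + 1) * fact i)"
        using \<delta> bound[of i] by (intro mult_left_mono) auto
      also have "\<dots> = C * (\<delta> * C) ^ i"
        by (simp add: power_mult_distrib)
      finally show ?thesis by (simp add: \<delta>)
    qed (use \<open>C \<ge> 1\<close> in \<open>simp add: f_def\<close>)
    show "summable (\<lambda>i. LINT x|lborel. norm (f i x))"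
      by (rule summable_comparison_test'[of "\<lambda>i. C * (1 / 2) ^ i" 0])
        (use le f_nonneg in \<open>auto intro!: summable_mult summable_geometric integral_nonneg\<close>)
  qed
  then have "integrable lborel (\<lambda>x. v x * cosh (\<delta> * x))"
    using f_sums by (simp add: sums_iff)
  from integrable_mult_right[OF this, of 2]
  have "integrable lborel (\<lambda>x. v x * exp (\<delta> * \<bar>x\<bar>))"
  proof (rule Bochner_Integration.integrable_bound)
    show "AE x in lborel. norm (v x * exp (\<delta> * \<bar>x\<bar>)) \<le> norm (2 * (v x * cosh (\<delta> * x)))"
    proof (rule AE_I2)
      fix x :: real
      have "exp (\<delta> * \<bar>x\<bar>) \<le> 2 * cosh (\<delta> * x)"
        by (cases "x \<ge> 0") (auto simp: cosh_def)
      then have "v x * exp (\<delta> * \<bar>x\<bar>) \<le> v x * (2 * cosh (\<delta> * x))"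
        by (intro mult_left_mono nonneg)
      then show "norm (v x * exp (\<delta> * \<bar>x\<bar>)) \<le> norm (2 * (v x * cosh (\<delta> * x)))"
        using nonneg[of x] by (simp add: abs_mult)
    qed
  qed measurable
  with \<delta> show ?thesis using that by blast
qed

section \<open>Determinacy of exponentially integrable functions\<close>

text \<open>Exponential integrability allows the integral of \<open>g x * exp (\<i> t x)\<close> to be expanded in
  moments of \<open>g\<close>, as long as \<open>\<bar>t\<bar> \<le> \<delta>\<close>: the partial sums of the exponential series are dominated by
  \<open>exp (\<delta> * \<bar>x\<bar>)\<close>.\<close>

lemma fourier_eq_0_of_moments_eq_0:
  fixes g :: "real \<Rightarrow> complex"
  assumes [measurable]: "g \<in> borel_measurable borel" and "\<delta> > 0"
    and int: "integrable lborel (\<lambda>x. norm (g x) * exp (\<delta> * \<bar>x\<bar>))"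
    and moments: "\<And>k. (LINT x|lborel. g x * of_real x ^ k) = 0"
    and t: "\<bar>t\<bar> \<le> \<delta>"
  shows "(LINT x|lborel. g x * iexp (t * x)) = 0"
proof -
  have int_k: "integrable lborel (\<lambda>x. g x * of_real x ^ k)" for k
  proof (rule Bochner_Integration.integrable_bound[OF integrable_mult_right[OF int, of "fact k / \<delta> ^ k"]])
    show "AE x in lborel. norm (g x * of_real x ^ k)
        \<le> norm (fact k / \<delta> ^ k * (norm (g x) * exp (\<delta> * \<bar>x\<bar>)))"
      using mult_left_mono[OF power_le_fact_mult_exp[OF \<open>\<delta> > 0\<close>, of _ k] norm_ge_zero[of "g _"]] \<open>\<delta> > 0\<close>
      by (auto simp: norm_mult norm_power abs_mult ac_simps)
  qed measurable
  define S where "S n x = (\<Sum>k<n. (\<i> * of_real t) ^ k / fact k * (g x * of_real x ^ k))" for n x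
  have "(\<lambda>n. LINT x|lborel. S n x) \<longlonglongrightarrow> (LINT x|lborel. g x * iexp (t * x))"
  proof (rule integral_dominated_convergence[OF _ _ int])
    show "AE x in lborel. (\<lambda>n. S n x) \<longlonglongrightarrow> g x * iexp (t * x)"
    proof (rule AE_I2)
      fix x :: real
      have "(\<lambda>k. (\<i> * of_real (t * x)) ^ k /\<^sub>R fact k) sums iexp (t * x)"
        by (rule exp_converges)
      from sums_mult[OF this, of "g x"] show "(\<lambda>n. S n x) \<longlonglongrightarrow> g x * iexp (t * x)"
        by (simp add: sums_def S_def scaleR_conv_of_real field_simps power_mult_distrib)
    qed
    show "AE x in lborel. norm (S n x) \<le> norm (g x) * exp (\<delta> * \<bar>x\<bar>)" for n
    proof (rule AE_I2)
      fix x :: real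
      have "norm (S n x) \<le> (\<Sum>k<n. norm ((\<i> * of_real t) ^ k / fact k * (g x * of_real x ^ k)))"
        unfolding S_def by (rule norm_sum)
      also have "\<dots> = norm (g x) * (\<Sum>k<n. (\<bar>t\<bar> * \<bar>x\<bar>) ^ k / fact k)"
        by (simp add: sum_distrib_left norm_mult norm_power norm_divide power_mult_distrib field_simps)
      also have "\<dots> \<le> norm (g x) * exp (\<bar>t\<bar> * \<bar>x\<bar>)"
        by (intro mult_left_mono sum_power_over_fact_le_exp) auto
      also have "\<dots> \<le> norm (g x) * exp (\<delta> * \<bar>x\<bar>)"
        using t by (intro mult_left_mono) (auto intro: mult_right_mono)
      finally show "norm (S n x) \<le> norm (g x) * exp (\<delta> * \<bar>x\<bar>)" .
    qed
  qed (auto simp: S_def)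
  moreover have "(LINT x|lborel. S n x) = 0" for n
    unfolding S_def using int_k moments by (subst Bochner_Integration.integral_sum) auto
  ultimately show ?thesis
    by (simp add: LIMSEQ_const_iff)
qed

text \<open>An exponentially integrable function is determined by its moments. The preceding lemma shows that
  the Fourier transform of \<open>h\<close> vanishes near 0; applied to \<open>h x * x ^ k * exp (\<i> s x)\<close> it shows that
  vanishing of all derivatives of the transform at \<open>s\<close> propagates to all points at
  distance at most \<open>\<delta> / 2\<close>, and so in finitely many steps to the whole line. Hence the positive
  and negative parts of \<open>h\<close>, normalised to probability densities, have the same characteristic
  function, and Levy's uniqueness theorem identifies them.\<close>

lemma AE_eq_0_of_moments_eq_0:
  fixes h :: "real \<Rightarrow> real"
  assumes [measurable]: "h \<in> borel_measurable borel" and "\<delta> > 0"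
    and int: "integrable lborel (\<lambda>x. \<bar>h x\<bar> * exp (\<delta> * \<bar>x\<bar>))"
    and moments: "\<And>k::nat. (LINT x|lborel. h x * x ^ k) = 0"
  shows "AE x in lborel. h x = 0"
proof -
  have int_h: "integrable lborel h"
    by (rule Bochner_Integration.integrable_bound[OF int])
      (use \<open>\<delta> > 0\<close> in \<open>auto simp: abs_mult mult_le_cancel_left1\<close>)
  have fourier: "\<bar>t\<bar> \<le> real N * (\<delta> / 2) \<Longrightarrow> (LINT x|lborel. of_real (h x) * of_real x ^ k * iexp (t * x)) = 0"
    for t N k
  proof (induction N arbitrary: t k)
    case 0
    have "(LINT x|lborel. complex_of_real (h x * x ^ k)) = 0"
      by (simp add: moments del: of_real_mult)
    then show ?case using 0 by simp
  next
    case (Suc N)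
    (* The step from t1 to t is at most \<delta>/2; the other half of \<delta> controls the factor x ^ k. *)
    define t1 t2 where "t1 = t * (real N / real (Suc N))" and "t2 = t / real (Suc N)"
    have "real N / real (Suc N) + 1 / real (Suc N) = 1"
      by (simp add: field_simps)
    then have t_eq: "t = t1 + t2"
      using distrib_left[of t "real N / real (Suc N)" "1 / real (Suc N)"]
      by (simp add: t1_def t2_def)
    have "\<bar>t\<bar> / real (Suc N) \<le> \<delta> / 2"
      using Suc.prems by (simp add: field_simps)
    then have t2: "\<bar>t2\<bar> \<le> \<delta> / 2" and t1: "\<bar>t1\<bar> \<le> real N * (\<delta> / 2)"
      using mult_left_mono[of "\<bar>t\<bar> / real (Suc N)" "\<delta> / 2" "real N"]
      by (auto simp: t1_def t2_def abs_mult field_simps)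
    let ?g = "\<lambda>x. of_real (h x) * of_real x ^ k * iexp (t1 * x)"
    have "(LINT x|lborel. ?g x * iexp (t2 * x)) = 0"
    proof (rule fourier_eq_0_of_moments_eq_0[OF _ _ _ _ t2])
      show "integrable lborel (\<lambda>x. norm (?g x) * exp (\<delta> / 2 * \<bar>x\<bar>))"
      proof (rule Bochner_Integration.integrable_bound[OF integrable_mult_right[OF int, of "fact k / (\<delta> / 2) ^ k"]])
        show "AE x in lborel. norm (norm (?g x) * exp (\<delta> / 2 * \<bar>x\<bar>))
            \<le> norm (fact k / (\<delta> / 2) ^ k * (\<bar>h x\<bar> * exp (\<delta> * \<bar>x\<bar>)))"
        proof (rule AE_I2)
          fix x :: real
          have "norm (norm (?g x) * exp (\<delta> / 2 * \<bar>x\<bar>)) = \<bar>h x\<bar> * (\<bar>x\<bar> ^ k * exp (\<delta> / 2 * \<bar>x\<bar>))"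
            by (simp add: norm_mult norm_power)
          also have "\<dots> \<le> \<bar>h x\<bar> * (fact k / (\<delta> / 2) ^ k * exp (\<delta> / 2 * \<bar>x\<bar>) * exp (\<delta> / 2 * \<bar>x\<bar>))"
            using \<open>\<delta> > 0\<close> by (intro mult_left_mono mult_right_mono power_le_fact_mult_exp) auto
          also have "exp (\<delta> / 2 * \<bar>x\<bar>) * exp (\<delta> / 2 * \<bar>x\<bar>) = exp (\<delta> * \<bar>x\<bar>)"
            by (simp flip: exp_add)
          then have "\<bar>h x\<bar> * (fact k / (\<delta> / 2) ^ k * exp (\<delta> / 2 * \<bar>x\<bar>) * exp (\<delta> / 2 * \<bar>x\<bar>))
              = norm (fact k / (\<delta> / 2) ^ k * (\<bar>h x\<bar> * exp (\<delta> * \<bar>x\<bar>)))"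
            using \<open>\<delta> > 0\<close> by (simp add: abs_mult)
          finally show "norm (norm (?g x) * exp (\<delta> / 2 * \<bar>x\<bar>))
              \<le> norm (fact k / (\<delta> / 2) ^ k * (\<bar>h x\<bar> * exp (\<delta> * \<bar>x\<bar>)))" .
        qed
      qed measurable
      show "(LINT x|lborel. ?g x * of_real x ^ j) = 0" for j
        using Suc.IH[OF t1, of "k + j"] by (simp add: power_add mult_ac)
    qed (use \<open>\<delta> > 0\<close> in auto)
    then show ?case
      by (simp add: t_eq distrib_left distrib_right exp_add mult_ac)
  qed
  have fourier_0: "(LINT x|lborel. of_real (h x) * iexp (t * x)) = 0" for t
  proof -
    obtain N :: nat where "\<bar>t\<bar> / (\<delta> / 2) \<le> real N"
      using real_arch_simple by blast
    then show ?thesis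
      using fourier[of t N 0] \<open>\<delta> > 0\<close> by (simp add: field_simps)
  qed
  define hp hm where "hp x = max (h x) 0" and "hm x = max (- h x) 0" for x
  have [measurable]: "hp \<in> borel_measurable borel" "hm \<in> borel_measurable borel"
    unfolding hp_def[abs_def] hm_def[abs_def] by measurable
  have nonneg: "hp x \<ge> 0" "hm x \<ge> 0" and h_eq: "h x = hp x - hm x" for x
    by (auto simp: hp_def hm_def)
  have ints: "integrable lborel hp" "integrable lborel hm"
    by (auto intro!: Bochner_Integration.integrable_bound[OF int_h] simp: hp_def[abs_def] hm_def[abs_def])
  define M where "M = (LINT x|lborel. hp x)"
  have M_eq: "M = (LINT x|lborel. hm x)"
    using moments[of 0] ints by (simp add: h_eq M_def)
  show ?thesis
  proof (cases "M = 0")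
    case True
    then have "AE x in lborel. hp x = 0" "AE x in lborel. hm x = 0"
      using integral_nonneg_eq_0_iff_AE[OF ints(1)] integral_nonneg_eq_0_iff_AE[OF ints(2)] nonneg M_eq
      by (auto simp: M_def)
    then show ?thesis by eventually_elim (simp add: h_eq)
  next
    case False
    then have "M > 0"
      using Bochner_Integration.integral_nonneg[of lborel hp] nonneg by (auto simp: M_def less_le)
    define \<mu> where "\<mu> k = density lborel (\<lambda>x. ennreal (k x / M))" for k :: "real \<Rightarrow> real"
    have distr: "real_distribution (\<mu> k)"
      if [measurable]: "k \<in> borel_measurable borel" and k: "\<And>x. k x \<ge> 0" "integrable lborel k" "(LINT x|lborel. k x) = M" for k
    proof -
      have "emeasure (\<mu> k) (space (\<mu> k)) = (\<integral>\<^sup>+x. ennreal (k x / M) \<partial>lborel)"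
        unfolding \<mu>_def by (simp add: emeasure_density)
      also have "\<dots> = ennreal (LINT x|lborel. k x / M)"
        using k \<open>M > 0\<close> by (intro nn_integral_eq_integral) auto
      finally have "prob_space (\<mu> k)"
        using k \<open>M > 0\<close> by (intro prob_spaceI) simp
      then show ?thesis
        by (auto simp: real_distribution_def real_distribution_axioms_def \<mu>_def)
    qed
    have char_eq: "char (\<mu> k) t = (LINT x|lborel. of_real (k x) * iexp (t * x)) / M"
      if [measurable]: "k \<in> borel_measurable borel" and k: "\<And>x. k x \<ge> 0" for k t
    proof -
      have "char (\<mu> k) t = (LINT x|lborel. (k x / M) *\<^sub>R iexp (t * x))"
        unfolding char_def \<mu>_def using k \<open>M > 0\<close> by (intro integral_density) auto
      also have "\<dots> = (LINT x|lborel. (of_real (k x) * iexp (t * x)) / M)"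
        by (simp add: scaleR_conv_of_real)
      finally show ?thesis by simp
    qed
    have int_iexp: "integrable lborel (\<lambda>x. of_real (k x) * iexp (t * x))"
      if "integrable lborel k" for k :: "real \<Rightarrow> real" and t
      by (rule Bochner_Integration.integrable_bound[OF that]) (use that in \<open>auto simp: norm_mult\<close>)
    have "char (\<mu> hp) = char (\<mu> hm)"
    proof
      fix t
      have "(LINT x|lborel. of_real (hp x) * iexp (t * x)) - (LINT x|lborel. of_real (hm x) * iexp (t * x)) = 0"
        using fourier_0[of t] int_iexp[OF ints(1), of t] int_iexp[OF ints(2), of t]
        by (simp add: h_eq left_diff_distrib)
      then show "char (\<mu> hp) t = char (\<mu> hm) t"
        by (simp add: char_eq nonneg)
    qed
    then have "\<mu> hp = \<mu> hm"
      using ints nonneg M_eq M_def by (intro Levy_uniqueness distr) auto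
    then have "AE x in lborel. ennreal (hp x / M) = ennreal (hm x / M)"
      unfolding \<mu>_def by (intro sigma_finite_measure.density_unique[OF sigma_finite_lborel]) auto
    then show ?thesis
      by eventually_elim (use nonneg \<open>M > 0\<close> in \<open>simp add: h_eq\<close>)
  qed
qed

lemma continuous_AE_eq_0:
  fixes f :: "real \<Rightarrow> real"
  assumes cont: "continuous_on UNIV f" and ae: "AE x in lborel. f x = 0"
  shows "f x = 0"
proof (rule ccontr)
  assume "f x \<noteq> 0"
  have "open {x. f x \<noteq> 0}"
    using cont by (intro open_Collect_neq) auto
  moreover have "negligible {x. f x \<noteq> 0}"
    using ae \<open>open _\<close> unfolding negligible_iff_null_sets
    by (intro null_sets_completionI) (simp add: AE_iff_null_sets borel_open)
  ultimately show False
    using open_not_negligible \<open>f x \<noteq> 0\<close> by blast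
qed

section \<open>From the Pearson equation of functionals to the differential equation\<close>

text \<open>For \<open>x \<le> 0\<close> the tail to the left of \<open>x\<close> lies where \<open>\<bar>t\<bar> \<ge> \<bar>x\<bar>\<close>. For \<open>x > 0\<close> the same is true of the
  tail to the right, which has the opposite integral because \<open>u\<close> has mean zero.\<close>

lemma tail_integral_exp_bound:
  fixes u :: "real \<Rightarrow> real"
  assumes "\<epsilon> > 0" and int_exp: "integrable lborel (\<lambda>x. \<bar>u x\<bar> * exp (\<epsilon> * \<bar>x\<bar>))"
    and int: "integrable lborel u" and zero: "(LINT x|lborel. u x) = 0"
  shows "\<bar>LINT t|lborel. indicator {..x} t * u t\<bar>
    \<le> (LINT t|lborel. \<bar>u t\<bar> * exp (\<epsilon> * \<bar>t\<bar>)) * exp (- \<epsilon> * \<bar>x\<bar>)"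
proof -
  have ind_int: "integrable lborel (\<lambda>t. indicator A t * u t)" if "A \<in> sets borel" for A
    using integrable_mult_indicator[OF _ int, of A] that by simp
  have tail: "\<bar>LINT t|lborel. indicator A t * u t\<bar>
      \<le> (LINT t|lborel. \<bar>u t\<bar> * exp (\<epsilon> * \<bar>t\<bar>)) * exp (- \<epsilon> * \<bar>x\<bar>)"
    if A: "A \<in> sets borel" "\<And>t. t \<in> A \<Longrightarrow> \<bar>x\<bar> \<le> \<bar>t\<bar>" for A
  proof -
    have "\<bar>LINT t|lborel. indicator A t * u t\<bar> \<le> (LINT t|lborel. \<bar>indicator A t * u t\<bar>)"
      using integral_norm_bound[of lborel "\<lambda>t. indicator A t * u t"] by simp
    also have "\<dots> \<le> (LINT t|lborel. (\<bar>u t\<bar> * exp (\<epsilon> * \<bar>t\<bar>)) * exp (- \<epsilon> * \<bar>x\<bar>))"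
    proof (rule integral_mono)
      fix t
      have "1 \<le> exp (\<epsilon> * \<bar>t\<bar>) * exp (- \<epsilon> * \<bar>x\<bar>)" if "t \<in> A"
        using A(2)[OF that] \<open>\<epsilon> > 0\<close> by (simp flip: exp_add)
      from mult_left_mono[OF this, of "\<bar>u t\<bar>"]
      show "\<bar>indicator A t * u t\<bar> \<le> (\<bar>u t\<bar> * exp (\<epsilon> * \<bar>t\<bar>)) * exp (- \<epsilon> * \<bar>x\<bar>)"
        by (auto split: split_indicator simp: abs_mult mult.assoc)
    qed (use ind_int[OF A(1)] int_exp in auto)
    also have "\<dots> = (LINT t|lborel. \<bar>u t\<bar> * exp (\<epsilon> * \<bar>t\<bar>)) * exp (- \<epsilon> * \<bar>x\<bar>)"
      by simp
    finally show ?thesis .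
  qed
  show ?thesis
  proof (cases "x \<le> 0")
    case True
    then show ?thesis by (intro tail) auto
  next
    case False
    have "(LINT t|lborel. indicator {..x} t * u t) + (LINT t|lborel. indicator {x<..} t * u t)
        = (LINT t|lborel. u t)"
      by (subst Bochner_Integration.integral_add[symmetric])
        (auto intro!: ind_int Bochner_Integration.integral_cong split: split_indicator)
    moreover have "\<bar>LINT t|lborel. indicator {x<..} t * u t\<bar>
        \<le> (LINT t|lborel. \<bar>u t\<bar> * exp (\<epsilon> * \<bar>t\<bar>)) * exp (- \<epsilon> * \<bar>x\<bar>)"
      using False by (intro tail) auto
    ultimately show ?thesis using zero by simp
  qed
qed

lemma has_vector_derivative_integral_atMost:
  fixes u :: "real \<Rightarrow> real"
  assumes cont: "continuous_on UNIV u" and int: "integrable lborel u"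
  shows "((\<lambda>x. LINT t|lborel. indicator {..x} t * u t) has_vector_derivative u x) (at x)"
    (is "(?G has_vector_derivative _) _")
proof -
  have [measurable]: "u \<in> borel_measurable borel"
    using cont by (rule borel_measurable_continuous_onI)
  have ind_int: "integrable lborel (\<lambda>t. indicator A t * u t)" if "A \<in> sets borel" for A
    using integrable_mult_indicator[OF _ int, of A] that by simp
  (* Near x the tail integral is a constant plus an integral over a compact interval, so the fundamental theorem applies. *)
  have G_eq: "?G y = ?G (x - 1) + integral {x - 1..y} u" if "x - 1 \<le> y" for y
  proof -
    have "?G y = (LINT t|lborel. indicator {..x - 1} t * u t + indicator {x - 1<..y} t * u t)"
      using that by (intro Bochner_Integration.integral_cong) (auto split: split_indicator)
    also have "\<dots> = ?G (x - 1) + (LINT t|lborel. indicator {x - 1<..y} t * u t)"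
      by (intro Bochner_Integration.integral_add ind_int) auto
    also have "(LINT t|lborel. indicator {x - 1<..y} t * u t) = (LINT t|lborel. indicator {x - 1..y} t * u t)"
    proof (rule integral_cong_AE)
      show "AE t in lborel. indicator {x - 1<..y} t * u t = indicator {x - 1..y} t * u t"
        using AE_lborel_singleton[of "x - 1"] by eventually_elim (auto split: split_indicator)
    qed measurable
    also have "\<dots> = integral {x - 1..y} u"
      using set_borel_integral_eq_integral(2)[of "{x - 1..y}" u] ind_int[of "{x - 1..y}"]
      by (simp add: set_lebesgue_integral_def set_integrable_def)
    finally show ?thesis .
  qed
  have "((\<lambda>y. integral {x - 1..y} u) has_vector_derivative u x) (at x within {x - 1..x + 1})"
    by (intro integral_has_vector_derivative continuous_on_subset[OF cont]) auto
  moreover have "at x within {x - 1..x + 1} = at x"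
    by (rule at_within_interior) simp
  ultimately have "((\<lambda>y. ?G (x - 1) + integral {x - 1..y} u) has_vector_derivative u x) (at x)"
    by (simp add: has_vector_derivative_add_const add.commute[of "?G (x - 1)"])
  then show ?thesis
    by (rule has_vector_derivative_transform_within_open[where S = "{x - 1<..<x + 1}"])
      (simp_all flip: G_eq)
qed

text \<open>The heart of the proof: the Pearson equation, known only when tested on polynomials, holds pointwise.
  Inserting \<open>q = x ^ n\<close> gives a recursion for the moments of \<open>v\<close>, hence factorial growth and
  exponential integrability of \<open>v\<close>. The function \<open>G x = \<integral>\<^bsub>-\<infinity>\<^esub>\<^bsup>x\<^esup> r v\<close> is then also exponentially
  small, because \<open>r v\<close> has mean zero (\<open>q = 1\<close>), and integration by parts turns the Pearson equation
  into equality of all moments of \<open>G\<close> and \<open>v\<close>. By determinacy \<open>v = G\<close>, and \<open>G' = r v\<close>.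
  Differentiability of \<open>v\<close>, even at endpoints of its support, is thus a conclusion.\<close>

lemma pearson_functional_imp_ode:
  fixes v :: "real \<Rightarrow> real"
  assumes cont: "continuous_on UNIV v" and nonneg: "\<And>x. v x \<ge> 0" and pos: "v x0 > 0"
    and int: "\<And>k::nat. integrable lborel (\<lambda>x. x ^ k * v x)"
    and pearson: "\<And>q. moment v (pderiv q + r * q) = 0"
  shows "(v has_real_derivative poly r x * v x) (at x)"
proof -
  have [measurable]: "v \<in> borel_measurable borel"
    using cont by (rule borel_measurable_continuous_onI)
  have int_poly: "integrable lborel (\<lambda>x. v x * poly q x)" for q
    by (rule integrable_times_poly[OF int])
  have int_v: "integrable lborel v"
    using int[of 0] by simp
  have rec: "real n * (LINT x|lborel. x ^ (n - 1) * v x) + (LINT x|lborel. v x * poly r x * x ^ n) = 0" for n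
  proof -
    have "(LINT x|lborel. v x * poly r x * x ^ n) = moment v (r * monom 1 n)"
      by (simp add: moment_def poly_monom mult_ac)
    moreover have "real n * (LINT x|lborel. x ^ (n - 1) * v x) = moment v (pderiv (monom 1 n))"
      by (simp add: moment_def pderiv_monom poly_monom mult_ac)
    moreover have "moment v (pderiv (monom 1 n)) + moment v (r * monom 1 n) = moment v (pderiv (monom 1 n) + r * monom 1 n)"
      unfolding moment_def by (simp add: distrib_left int_poly[unfolded poly_mult] int_poly
          flip: Bochner_Integration.integral_add poly_mult)
    ultimately show ?thesis
      using pearson by simp
  qed
  (* The recursion can be solved for the highest moment only if r is nonzero; r = 0 would make the total mass vanish. *)
  have "r \<noteq> 0"
  proof
    assume "r = 0"
    then have "(LINT x|lborel. v x) = 0"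
      using rec[of 1] by simp
    then have "AE x in lborel. v x = 0"
      using integral_nonneg_eq_0_iff_AE[OF int_v] nonneg by simp
    then show False
      using continuous_AE_eq_0[OF cont, of x0] pos by simp
  qed
  obtain C where "C \<ge> 1" and C: "\<And>n. \<bar>LINT x|lborel. x ^ n * v x\<bar> \<le> C ^ (n + 1) * fact n"
  proof (rule recursion_imp_factorial_growth[where s = "\<lambda>n. LINT x|lborel. x ^ n * v x" and r = "coeff r" and d = "degree r"])
    show "real n * (LINT x|lborel. x ^ (n - 1) * v x)
        + (\<Sum>j\<le>degree r. coeff r j * (LINT x|lborel. x ^ (n + j) * v x)) = 0" for n
    proof -
      have "(LINT x|lborel. v x * poly r x * x ^ n) = (LINT x|lborel. (\<Sum>j\<le>degree r. coeff r j * (x ^ (n + j) * v x)))"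
        by (simp add: poly_altdef sum_distrib_left sum_distrib_right power_add mult_ac)
      also have "\<dots> = (\<Sum>j\<le>degree r. coeff r j * (LINT x|lborel. x ^ (n + j) * v x))"
        using int by (subst Bochner_Integration.integral_sum) auto
      finally show ?thesis using rec[of n] by simp
    qed
  qed (use \<open>r \<noteq> 0\<close> in auto)
  then obtain \<delta> where "\<delta> > 0" and int_exp: "integrable lborel (\<lambda>x. v x * exp (\<delta> * \<bar>x\<bar>))"
    using exp_integrable_of_moment_growth[OF _ nonneg int \<open>C \<ge> 1\<close> C] by auto
  define u where "u x = v x * poly r x" for x
  (* Half of the exponential weight pays for the polynomial factor r. *)
  define \<epsilon> where "\<epsilon> = \<delta> / 2"
  have \<epsilon>: "\<epsilon> > 0" "\<delta> = \<epsilon> + \<epsilon>"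
    using \<open>\<delta> > 0\<close> by (auto simp: \<epsilon>_def)
  have u_cont: "continuous_on UNIV u"
    unfolding u_def by (intro continuous_intros cont)
  then have [measurable]: "u \<in> borel_measurable borel"
    by (rule borel_measurable_continuous_onI)
  have u_int: "integrable lborel u" and u_0: "(LINT x|lborel. u x) = 0"
    using int_poly[of r] rec[of 0] by (simp_all add: u_def[abs_def])
  obtain K where K: "K \<ge> 0" "\<And>x. \<bar>poly r x\<bar> \<le> K * exp (\<epsilon> * \<bar>x\<bar>)"
    using poly_le_exp[OF \<epsilon>(1), of r] by blast
  have u_exp: "integrable lborel (\<lambda>x. \<bar>u x\<bar> * exp (\<epsilon> * \<bar>x\<bar>))"
  proof (rule Bochner_Integration.integrable_bound[OF integrable_mult_right[OF int_exp, of K]])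
    show "AE x in lborel. norm (\<bar>u x\<bar> * exp (\<epsilon> * \<bar>x\<bar>)) \<le> norm (K * (v x * exp (\<delta> * \<bar>x\<bar>)))"
    proof (rule AE_I2)
      fix x
      have "v x * exp (\<epsilon> * \<bar>x\<bar>) * \<bar>poly r x\<bar> \<le> v x * exp (\<epsilon> * \<bar>x\<bar>) * (K * exp (\<epsilon> * \<bar>x\<bar>))"
        using nonneg[of x] by (intro mult_left_mono K) auto
      then show "norm (\<bar>u x\<bar> * exp (\<epsilon> * \<bar>x\<bar>)) \<le> norm (K * (v x * exp (\<delta> * \<bar>x\<bar>)))"
        using nonneg[of x] K(1)
        unfolding \<epsilon>(2) distrib_right exp_add by (simp add: u_def abs_mult mult_ac)
    qed
  qed measurable
  define G where "G x = (LINT t|lborel. indicator {..x} t * u t)" for x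
  define B where "B = (LINT t|lborel. \<bar>u t\<bar> * exp (\<epsilon> * \<bar>t\<bar>))"
  have G_deriv: "(G has_vector_derivative u x) (at x)" for x
    unfolding G_def by (rule has_vector_derivative_integral_atMost[OF u_cont u_int])
  have G_bound: "\<bar>G x\<bar> \<le> B * exp (- \<epsilon> * \<bar>x\<bar>)" for x
    unfolding G_def B_def by (rule tail_integral_exp_bound[OF \<epsilon>(1) u_exp u_int u_0])
  have G_cont: "continuous_on UNIV G"
    using G_deriv has_vector_derivative_continuous continuous_at_imp_continuous_on by blast
  then have [measurable]: "G \<in> borel_measurable borel"
    by (rule borel_measurable_continuous_onI)
  have "B \<ge> 0"
    unfolding B_def by (intro Bochner_Integration.integral_nonneg) auto
  have G_exp: "integrable lborel (\<lambda>x. \<bar>G x\<bar> * exp (\<epsilon> / 2 * \<bar>x\<bar>))"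
  proof (rule Bochner_Integration.integrable_bound[OF integrable_mult_right[OF integrable_exp_neg_abs[of "\<epsilon> / 2"], of B]])
    show "AE x in lborel. norm (\<bar>G x\<bar> * exp (\<epsilon> / 2 * \<bar>x\<bar>)) \<le> norm (B * exp (- (\<epsilon> / 2) * \<bar>x\<bar>))"
    proof (rule AE_I2)
      fix x
      have "\<bar>G x\<bar> * exp (\<epsilon> / 2 * \<bar>x\<bar>) \<le> B * exp (- \<epsilon> * \<bar>x\<bar>) * exp (\<epsilon> / 2 * \<bar>x\<bar>)"
        by (intro mult_right_mono G_bound) auto
      also have "\<dots> = B * exp (- (\<epsilon> / 2) * \<bar>x\<bar>)"
        by (simp add: mult.assoc flip: exp_add)
      finally show "norm (\<bar>G x\<bar> * exp (\<epsilon> / 2 * \<bar>x\<bar>)) \<le> norm (B * exp (- (\<epsilon> / 2) * \<bar>x\<bar>))"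
        using \<open>B \<ge> 0\<close> by (simp add: abs_mult)
    qed
  qed (use \<epsilon> in auto)
  have G_int: "integrable lborel (\<lambda>x. G x * x ^ k)" for k
  proof (rule Bochner_Integration.integrable_bound[OF integrable_mult_right[OF G_exp, of "fact k / (\<epsilon> / 2) ^ k"]])
    show "AE x in lborel. norm (G x * x ^ k) \<le> norm (fact k / (\<epsilon> / 2) ^ k * (\<bar>G x\<bar> * exp (\<epsilon> / 2 * \<bar>x\<bar>)))"
    proof (rule AE_I2)
      fix x
      have "\<bar>G x\<bar> * \<bar>x\<bar> ^ k \<le> \<bar>G x\<bar> * (fact k / (\<epsilon> / 2) ^ k * exp (\<epsilon> / 2 * \<bar>x\<bar>))"
        using \<epsilon>(1) by (intro mult_left_mono power_le_fact_mult_exp) auto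
      then show "norm (G x * x ^ k) \<le> norm (fact k / (\<epsilon> / 2) ^ k * (\<bar>G x\<bar> * exp (\<epsilon> / 2 * \<bar>x\<bar>)))"
        using \<epsilon>(1) by (simp add: abs_mult power_abs mult_ac)
    qed
  qed measurable
  have G_moment: "(LINT x|lborel. G x * x ^ k) = (LINT x|lborel. x ^ k * v x)" for k
  proof -
    let ?f' = "\<lambda>x. u x * x ^ Suc k + real (Suc k) * (G x * x ^ k)"
    have u_int': "integrable lborel (\<lambda>x. u x * x ^ Suc k)"
      using int_poly[of "r * monom 1 (Suc k)"] by (simp add: u_def poly_monom mult_ac)
    then have f'_int: "integrable lborel ?f'"
      by (intro Bochner_Integration.integrable_add integrable_mult_right G_int)
    have "integral UNIV ?f' = 0"
    proof (rule integral_derivative_of_integrable_eq_0[where f = "\<lambda>x. G x * x ^ Suc k" and S = "{}"])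
      show "continuous_on UNIV (\<lambda>x. G x * x ^ Suc k)"
        by (intro continuous_intros G_cont)
      show "((\<lambda>x. G x * x ^ Suc k) has_vector_derivative ?f' x) (at x)" for x
        using DERIV_mult[OF G_deriv[of x, folded has_real_derivative_iff_has_vector_derivative] DERIV_pow[of "Suc k" x]]
        unfolding has_real_derivative_iff_has_vector_derivative[symmetric]
        by (simp add: mult_ac)
    qed (use G_int[of "Suc k"] f'_int in \<open>auto intro: integrable_on_lborel\<close>)
    then have "(LINT x|lborel. u x * x ^ Suc k) + real (Suc k) * (LINT x|lborel. G x * x ^ k) = 0"
      using integral_lborel[OF f'_int] Bochner_Integration.integral_add[OF u_int' integrable_mult_right[OF G_int[of k]], of "real (Suc k)"]
      by simp
    moreover have "real (Suc k) * (LINT x|lborel. x ^ k * v x) + (LINT x|lborel. u x * x ^ Suc k) = 0"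
      using rec[of "Suc k"] by (simp add: u_def del: of_nat_Suc power_Suc)
    ultimately have "real (Suc k) * (LINT x|lborel. G x * x ^ k) = real (Suc k) * (LINT x|lborel. x ^ k * v x)"
      by linarith
    then show ?thesis
      by (simp del: of_nat_Suc)
  qed
  have "AE x in lborel. v x - G x = 0"
  proof (rule AE_eq_0_of_moments_eq_0[where \<delta> = "\<epsilon> / 2"])
    show "integrable lborel (\<lambda>x. \<bar>v x - G x\<bar> * exp (\<epsilon> / 2 * \<bar>x\<bar>))"
    proof (rule Bochner_Integration.integrable_bound[OF Bochner_Integration.integrable_add[OF int_exp G_exp]])
      show "AE x in lborel. norm (\<bar>v x - G x\<bar> * exp (\<epsilon> / 2 * \<bar>x\<bar>))
          \<le> norm (v x * exp (\<delta> * \<bar>x\<bar>) + \<bar>G x\<bar> * exp (\<epsilon> / 2 * \<bar>x\<bar>))"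
      proof (rule AE_I2)
        fix x
        have "\<epsilon> / 2 * \<bar>x\<bar> \<le> \<delta> * \<bar>x\<bar>"
          using \<epsilon> by (intro mult_right_mono) auto
        then have "v x * exp (\<epsilon> / 2 * \<bar>x\<bar>) \<le> v x * exp (\<delta> * \<bar>x\<bar>)"
          by (intro mult_left_mono nonneg) auto
        moreover have "\<bar>v x - G x\<bar> * exp (\<epsilon> / 2 * \<bar>x\<bar>) \<le> (v x + \<bar>G x\<bar>) * exp (\<epsilon> / 2 * \<bar>x\<bar>)"
          using nonneg[of x] by (intro mult_right_mono) auto
        ultimately have "\<bar>v x - G x\<bar> * exp (\<epsilon> / 2 * \<bar>x\<bar>) \<le> v x * exp (\<delta> * \<bar>x\<bar>) + \<bar>G x\<bar> * exp (\<epsilon> / 2 * \<bar>x\<bar>)"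
          by (simp add: distrib_right)
        then show "norm (\<bar>v x - G x\<bar> * exp (\<epsilon> / 2 * \<bar>x\<bar>))
            \<le> norm (v x * exp (\<delta> * \<bar>x\<bar>) + \<bar>G x\<bar> * exp (\<epsilon> / 2 * \<bar>x\<bar>))"
          by (auto intro: order_trans[OF _ abs_ge_self])
      qed
    qed measurable
    show "(LINT x|lborel. (v x - G x) * x ^ k) = 0" for k
      using G_moment[of k] G_int[of k] int[of k] by (simp add: algebra_simps)
  qed (use \<epsilon> in auto)
  then have "v x = G x" for x
    using continuous_AE_eq_0[of "\<lambda>x. v x - G x" x] cont G_cont by (simp add: continuous_on_diff)
  then have "v = G" by auto
  then show ?thesis
    using G_deriv[of x] by (simp add: has_real_derivative_iff_has_vector_derivative u_def mult.commute)
qed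

lemma ex_pderiv_eq:
  fixes r :: "real poly"
  shows "\<exists>R. pderiv R = r"
proof (induction "degree r" arbitrary: r rule: less_induct)
  case less
  show ?case
  proof (cases "r = 0")
    case True
    then show ?thesis by (intro exI[of _ 0]) simp
  next
    case False
    let ?m = "monom (lead_coeff r / real (Suc (degree r))) (Suc (degree r))"
    define q where "q = r - monom (lead_coeff r) (degree r)"
    have m: "pderiv ?m = monom (lead_coeff r) (degree r)"
      by (simp add: pderiv_monom del: of_nat_Suc)
    have "\<exists>Q. pderiv Q = q"
    proof (cases "q = 0")
      case True
      then show ?thesis by (intro exI[of _ 0]) simp
    next
      case nz: False
      have "degree q \<le> degree r"
        unfolding q_def by (intro degree_diff_le degree_monom_le) auto
      moreover have "coeff q (degree r) = 0"
        by (simp add: q_def)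
      ultimately have "degree q < degree r"
        using nz by (metis le_neq_implies_less leading_coeff_0_iff)
      then show ?thesis by (rule less)
    qed
    then obtain Q where "pderiv Q = q" ..
    then have "pderiv (Q + ?m) = r"
      by (simp add: pderiv_add m q_def del: of_nat_Suc)
    then show ?thesis ..
  qed
qed

text \<open>The solution is positive everywhere as soon as it is positive somewhere. This is what later
  rules out intervals other than the whole line.\<close>

lemma linear_ode_solution:
  fixes v :: "real \<Rightarrow> real"
  assumes ode: "\<And>x. (v has_real_derivative poly r x * v x) (at x)" and pos: "v x0 > 0"
  obtains c where "\<And>x. v x = exp (- poly c x)"
proof -
  obtain R where R: "pderiv R = r"
    using ex_pderiv_eq by blast
  define A where "A = v x0 * exp (- poly R x0)"
  have "((\<lambda>x. v x * exp (- poly R x)) has_real_derivative 0) (at x)" for x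
    by (auto intro!: derivative_eq_intros ode poly_DERIV simp: R algebra_simps)
  then have "v x * exp (- poly R x) = A" for x
    unfolding A_def using DERIV_isconst_all by blast
  then have "v x = A * exp (poly R x)" for x
    by (simp add: exp_minus field_simps)
  moreover have "A > 0"
    using pos by (simp add: A_def)
  ultimately have "v x = exp (- poly (- (R + [:ln A:])) x)" for x
    by (simp add: exp_add)
  then show ?thesis using that by blast
qed

section \<open>Integrable exponentials of polynomials\<close>

text \<open>Otherwise the function is at least 1 on a half-line.\<close>

lemma integrable_exp_neg_poly_imp_lead_coeff_pos:
  fixes c :: "real poly"
  assumes "integrable lborel (\<lambda>x. exp (- poly c x))"
  shows "lead_coeff c > 0"
proof (rule ccontr)
  assume "\<not> ?thesis"
  then consider "c = 0" | "lead_coeff (- c) > 0"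
    by (metis coeff_minus degree_minus leading_coeff_0_iff linorder_neqE_linordered_idom neg_0_less_iff_less)
  then obtain n where "\<And>x. x \<ge> n \<Longrightarrow> - poly c x \<ge> 0"
  proof cases
    case 2
    then obtain n where "\<forall>x\<ge>n. lead_coeff (- c) \<le> poly (- c) x"
      using poly_pinfty_gt_lc by blast
    with 2 have "- poly c x \<ge> 0" if "x \<ge> n" for x
      using that by fastforce
    then show ?thesis using that by blast
  qed (use that in auto)
  moreover obtain t where "t \<ge> n" "\<bar>exp (- poly c t)\<bar> < 1"
    using integrable_small_at_top[OF assms, of 1] by auto
  ultimately show False by fastforce
qed

text \<open>Under the reflection \<open>x \<mapsto> -x\<close> the leading coefficient of a polynomial of odd degree changes sign.\<close>

lemma integrable_exp_neg_poly_imp_even: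
  fixes c :: "real poly"
  assumes int: "integrable lborel (\<lambda>x. exp (- poly c x))"
  shows "even (degree c)"
proof -
  have "integrable lborel (\<lambda>x. exp (- poly (pcompose c [:0, -1:]) x))"
    using lborel_integrable_real_affine[OF int, of "-1" 0] by (simp add: poly_pcompose)
  then have "lead_coeff (pcompose c [:0, -1:]) > 0"
    by (rule integrable_exp_neg_poly_imp_lead_coeff_pos)
  then have "lead_coeff c * (- 1) ^ degree c > 0"
    by (simp add: lead_coeff_comp)
  then show ?thesis
    using integrable_exp_neg_poly_imp_lead_coeff_pos[OF int]
    by (cases "even (degree c)") auto
qed

section \<open>The differentiation matrix\<close>

lemma W_function_has_derivative:
  assumes "(w has_real_derivative w') (at x)" "w x > 0"
  shows "(W_function w p m has_real_derivative
     (w' / (2 * sqrt (w x)) * poly (p m) x + sqrt (w x) * poly (pderiv (p m)) x)) (at x)"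
  unfolding W_function_def
  using assms by (auto intro!: derivative_eq_intros poly_DERIV simp: field_simps)

lemma deriv_W_function_times_W_function:
  assumes "(w has_real_derivative w') (at x)" "w x > 0"
  shows "deriv (W_function w p m) x * W_function w p n x
    = w' / 2 * poly (p m * p n) x + w x * poly (pderiv (p m) * p n) x"
proof -
  define t where "t = sqrt (w x)"
  have t: "t > 0" "w x = t * t"
    using assms(2) by (auto simp: t_def)
  have deriv: "deriv (W_function w p m) x = w' / (2 * t) * poly (p m) x + t * poly (pderiv (p m)) x"
    using DERIV_imp_deriv[OF W_function_has_derivative[OF assms]] by (simp add: t_def)
  have W: "W_function w p n x = t * poly (p n) x"
    by (simp add: W_function_def t_def)
  show ?thesis
    unfolding deriv W t(2) using t(1) by (simp add: field_simps)
qed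

text \<open>Twice the integrand differs from \<open>w (p\<^sub>m' p\<^sub>n - p\<^sub>m p\<^sub>n')\<close> by the derivative of \<open>w p\<^sub>m p\<^sub>n\<close>, whose
  integral is 0. So the matrix is antisymmetric and depends on \<open>w\<close> only through its moments.
  The exceptional points are the finite endpoints; for an infinite endpoint \<open>real_of_ereal\<close> yields 0,
  and one more exceptional point is harmless.\<close>

lemma diff_matrix_eq_moment:
  fixes a b :: ereal and w :: "real \<Rightarrow> real"
  defines "v \<equiv> \<lambda>x. indicator (einterval a b) x * w x"
  assumes pos: "\<And>x. x \<in> einterval a b \<Longrightarrow> w x > 0"
    and deriv: "\<And>x. x \<in> einterval a b \<Longrightarrow> (w has_real_derivative w' x) (at x)"
    and cont: "continuous_on UNIV v"
    and int: "\<And>k::nat. integrable lborel (\<lambda>x. x ^ k * v x)"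
    and exists: "(\<lambda>x. deriv (W_function w p m) x * W_function w p n x) integrable_on einterval a b"
  shows "diff_matrix a b w p m n = moment v (pderiv (p m) * p n - p m * pderiv (p n)) / 2"
proof -
  let ?I = "einterval a b"
  define \<phi> where "\<phi> x = (if x \<in> ?I then deriv (W_function w p m) x * W_function w p n x else 0)" for x
  define q where "q = pderiv (p m) * p n - p m * pderiv (p n)"
  have \<phi>_int: "\<phi> integrable_on UNIV" "integral UNIV \<phi> = diff_matrix a b w p m n"
    using exists unfolding \<phi>_def[abs_def] diff_matrix_def
    by (simp_all only: integrable_restrict_UNIV integral_restrict_UNIV)
  have vq_int: "integrable lborel (\<lambda>x. v x * poly q x)" for q
    by (rule integrable_times_poly[OF int])
  have q_int: "(\<lambda>x. v x * poly q x) integrable_on UNIV" "integral UNIV (\<lambda>x. v x * poly q x) = moment v q"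
    using integrable_on_lborel[OF vq_int] integral_lborel[OF vq_int] by (simp_all add: moment_def)
  have "integral UNIV (\<lambda>x. 2 * \<phi> x - v x * poly q x) = 0"
  proof (rule integral_derivative_of_integrable_eq_0[where S = "{real_of_ereal a, real_of_ereal b}"
        and f = "\<lambda>x. v x * poly (p m * p n) x"])
    show "continuous_on UNIV (\<lambda>x. v x * poly (p m * p n) x)"
      by (intro continuous_intros cont)
    show "(\<lambda>x. 2 * \<phi> x - v x * poly q x) integrable_on UNIV"
      by (intro integrable_diff integrable_on_mult_right \<phi>_int q_int)
    fix x assume x: "x \<notin> {real_of_ereal a, real_of_ereal b}"
    show "((\<lambda>x. v x * poly (p m * p n) x) has_vector_derivative (2 * \<phi> x - v x * poly q x)) (at x)"
    proof (cases "x \<in> ?I")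
      case True
      have "((\<lambda>x. w x * poly (p m * p n) x) has_real_derivative
          (w' x * poly (p m * p n) x + poly (pderiv (p m * p n)) x * w x)) (at x)"
        by (intro DERIV_mult poly_DERIV deriv True)
      also have "w' x * poly (p m * p n) x + poly (pderiv (p m * p n)) x * w x = 2 * \<phi> x - v x * poly q x"
        using True deriv_W_function_times_W_function[OF deriv[OF True] pos[OF True]]
        by (simp add: \<phi>_def v_def q_def pderiv_mult algebra_simps)
      finally show ?thesis
        unfolding has_real_derivative_iff_has_vector_derivative
        by (rule has_vector_derivative_transform_within_open[OF _ open_einterval True]) (simp add: v_def)
    next
      case False
      let ?S = "{y. ereal y < a} \<union> {y. b < ereal y}"
      have "open ?S"
        by (intro open_Un open_Collect_less continuous_intros)
      moreover have "x \<in> ?S"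
        using x False by (cases a; cases b; simp add: einterval_iff; linarith)
      moreover have "0 = v y * poly (p m * p n) y" if "y \<in> ?S" for y
        using that by (auto simp: v_def einterval_iff split: split_indicator)
      ultimately have "((\<lambda>x. v x * poly (p m * p n) x) has_vector_derivative 0) (at x)"
        by (rule has_vector_derivative_transform_within_open[OF has_vector_derivative_const])
      then show ?thesis
        using False by (simp add: \<phi>_def v_def)
    qed
  qed (use vq_int[of "p m * p n"] in auto)
  then have "2 * diff_matrix a b w p m n - moment v q = 0"
    using \<phi>_int q_int by (simp add: Henstock_Kurzweil_Integration.integral_diff integrable_on_mult_right)
  then show ?thesis by (simp add: q_def)
qed

theorem theorem2:
  fixes a b :: ereal and w :: "real \<Rightarrow> real" and p :: "nat \<Rightarrow> real poly"
  assumes "a < b"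
    and "weight_function a b w"
    and "vanishes_at_endpoints a b w"
    and "orthonormal_polys a b w p"
  shows "(diff_matrix_exists a b w p \<and> banded (diff_matrix a b w p)) \<longleftrightarrow>
         (einterval a b = UNIV \<and>
          (\<exists>c :: real poly. even (degree c) \<and> lead_coeff c > 0 \<and>
             (\<forall>x. w x = exp (- poly c x))))"
proof -
  let ?I = "einterval a b"
  define v where "v = (\<lambda>x. indicator ?I x * w x)"
  have w_pos: "w x > 0" if "x \<in> ?I" for x
    using assms(2) that by (auto simp: weight_function_def)
  then have v_nonneg: "v x \<ge> 0" for x
    by (auto simp: v_def less_imp_le split: split_indicator)
  obtain w' where w_deriv: "\<And>x. x \<in> ?I \<Longrightarrow> (w has_real_derivative w' x) (at x)"
    using assms(2) unfolding weight_function_def C1_differentiable_on_def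
      has_real_derivative_iff_has_vector_derivative by blast
  have v_cont: "continuous_on UNIV v"
    unfolding v_def using w_deriv
    by (intro continuous_zero_extension assms continuous_at_imp_continuous_on ballI DERIV_isCont)
  have v_int: "integrable lborel (\<lambda>x. x ^ k * v x)" for k :: nat
    using assms(2) by (simp add: weight_function_def set_integrable_def v_def mult.left_commute)
  have deg: "degree (p n) = n" and lead: "lead_coeff (p n) > 0" for n
    using assms(4) unfolding orthonormal_polys_def by blast+
  have nz: "p n \<noteq> 0" for n
    using lead[of n] by auto
  have orth: "moment v (p m * p n) = (if m = n then 1 else 0)" for m n
    using assms(4) by (simp add: orthonormal_polys_def set_lebesgue_integral_def moment_def v_def mult_ac)
  have D_eq: "diff_matrix a b w p m n = moment v (pderiv (p m) * p n - p m * pderiv (p n)) / 2"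
    if "diff_matrix_exists a b w p" for m n
    unfolding v_def
  proof (rule diff_matrix_eq_moment[OF w_pos w_deriv])
    show "(\<lambda>x. deriv (W_function w p m) x * W_function w p n x) integrable_on ?I"
      using that unfolding diff_matrix_exists_def by blast
  qed (use v_cont v_int in \<open>simp_all only: v_def\<close>)
  show ?thesis
  proof (rule iffI; elim conjE exE)
    assume ex: "diff_matrix_exists a b w p" and "banded (diff_matrix a b w p)"
    then obtain L where L: "\<And>m n. \<bar>int m - int n\<bar> \<ge> int L + 1 \<Longrightarrow> diff_matrix a b w p m n = 0"
      by (auto simp: banded_def)
    obtain k where p0: "p 0 = [:k:]" and "k \<noteq> 0"
      using deg[of 0] nz[of 0] by (auto elim!: degree_eq_zeroE)
    have "moment v (pderiv (p m)) = 0" if "m > L" for m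
    proof -
      have "k * moment v (pderiv (p m)) / 2 = diff_matrix a b w p m 0"
        unfolding D_eq[OF ex] by (simp add: p0 moment_smult)
      also have "\<dots> = 0"
        using that by (intro L) auto
      finally show ?thesis using \<open>k \<noteq> 0\<close> by simp
    qed
    then obtain r where r: "\<And>q. moment v (pderiv q + r * q) = 0"
      using ex_pearson_functional[OF v_int deg nz orth] by blast
    obtain x0 where "x0 \<in> ?I"
      using einterval_nonempty[OF \<open>a < b\<close>] by blast
    then have "v x0 > 0"
      using w_pos by (simp add: v_def)
    then obtain c where c: "\<And>x. v x = exp (- poly c x)"
      using linear_ode_solution[of v r x0] pearson_functional_imp_ode[OF v_cont v_nonneg _ v_int r] by blast
    have "x \<in> ?I" for x
      using c[of x] by (auto simp: v_def split: split_indicator_asm)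
    then have I: "?I = UNIV" by blast
    have w_eq: "w x = exp (- poly c x)" for x
      using c[of x] by (simp add: v_def I)
    have "integrable lborel (\<lambda>x. exp (- poly c x))"
      using v_int[of 0] c by simp
    then show "?I = UNIV \<and> (\<exists>c. even (degree c) \<and> lead_coeff c > 0 \<and> (\<forall>x. w x = exp (- poly c x)))"
      using integrable_exp_neg_poly_imp_even integrable_exp_neg_poly_imp_lead_coeff_pos w_eq I by blast
  next
    fix c :: "real poly"
    assume I: "?I = UNIV" and w_eq: "\<forall>x. w x = exp (- poly c x)"
    have v_eq: "v = w"
      by (simp add: v_def I)
    define s where "s m = pderiv (p m) - smult (1 / 2) (pderiv c * p m)" for m
    have w_fun: "w = (\<lambda>x. exp (- poly c x))"
      using w_eq by (intro ext) blast
    have w_deriv': "(w has_real_derivative - poly (pderiv c) x * w x) (at x)" for x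
    proof -
      have "((\<lambda>x. exp (- poly c x)) has_real_derivative exp (- poly c x) * - poly (pderiv c) x) (at x)"
        by (intro DERIV_chain2[OF DERIV_exp] DERIV_minus poly_DERIV)
      then show ?thesis
        unfolding w_fun by (simp add: mult.commute)
    qed
    have integrand: "deriv (W_function w p m) x * W_function w p n x = v x * poly (s m * p n) x" for m n x
    proof -
      have "w x > 0"
        by (rule w_pos) (simp add: I)
      then show ?thesis
        unfolding deriv_W_function_times_W_function[OF w_deriv' \<open>w x > 0\<close>] v_eq
        by (simp add: s_def field_simps)
    qed
    have s_int: "integrable lborel (\<lambda>x. v x * poly (s m * p n) x)" for m n
      by (rule integrable_times_poly[OF v_int])
    have ex: "diff_matrix_exists a b w p"
      unfolding diff_matrix_exists_def I integrand by (intro allI integrable_on_lborel s_int)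
    have D_s: "diff_matrix a b w p m n = moment v (s m * p n)" for m n
      unfolding diff_matrix_def I integrand moment_def by (rule integral_lborel[OF s_int])
    have D_upper: "diff_matrix a b w p m n = 0" if "n > m + degree c" for m n
    proof -
      have "degree (s m) \<le> m + degree c"
        unfolding s_def using degree_mult_le[of "pderiv c" "p m"]
        by (intro degree_diff_le order_trans[OF degree_smult_le]) (auto simp: degree_pderiv deg)
      then have "degree (s m) < n"
        using that by simp
      moreover have "moment v (p i * p j) = 0" if "i \<noteq> j" for i j
        using that by (simp add: orth)
      ultimately show ?thesis
        unfolding D_s by (rule moment_orthogonal_lower_degree[OF v_int deg nz, rotated])
    qed
    have D_antisym: "diff_matrix a b w p m n = - diff_matrix a b w p n m" for m n
    proof -
      have "pderiv (p m) * p n - p m * pderiv (p n) = smult (- 1) (pderiv (p n) * p m - p n * pderiv (p m))"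
        by (simp add: mult.commute)
      then show ?thesis
        unfolding D_eq[OF ex] by (simp only: moment_smult)
    qed
    have "banded (diff_matrix a b w p)"
      unfolding banded_def
    proof (intro exI[of _ "degree c"] allI impI)
      fix m n :: nat
      assume "int (degree c) + 1 \<le> \<bar>int m - int n\<bar>"
      then consider "n > m + degree c" | "m > n + degree c"
        by linarith
      then show "diff_matrix a b w p m n = 0"
        using D_upper[of m n] D_upper[of n m] D_antisym[of m n] by cases auto
    qed
    with ex show "diff_matrix_exists a b w p \<and> banded (diff_matrix a b w p)" ..
  qed
qed

end
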